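(* Let $R$ be a unital ring with involution $*$, let $a\in R$ and let $n$ be a positive integer. Then the following conditions are equivalent: (1) $a\in R^{\dagger}$; (2) there exists a projection $p\in R$ such that $ap=0$ and $(a^{*}a)^{n}+p$ is invertible; (3) there exists a projection $p\in R$ such that $ap=0$ and $(a^{*}a)^{n}+p$ is right invertible; (4) there exists an idempotent $e\in R$ such that $ae=0$ and $(a^{*}a)^{n}+e$ is invertible; (5) there exists an idempotent $e\in R$ such that $ae=0$ and $(a^{*}a)^{n}+e$ is right invertible; (6) there exists $b\in R$ such that $ab=0$ and $(a^{*}a)^{n}+b$ is invertible; (7) there exists $b\in R$ such that $ab=0$ and $(a^{*}a)^{n}+b$ is right invertible. In this case, $a^{\dagger}=x_{i}^{*}(a^{*}a)^{2n-1}x_{i}a^{*}$ for $i\in\{1,2,3\}$, where $x_1,x_2,x_3\in R$ satisfy $1=((a^{*}a)^{n}+p)x_{1}=((a^{*}a)^{n}+e)x_{2}=((a^{*}a)^{n}+b)x_{3}$, with $p$, $e$, $b$ as in (3), (5), (7) respectively.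
   Context: $R$ is a unital ring with an involution $a\mapsto a^*$, i.e. $(a^* )^*=a$, $(ab)^*=b^*a^*$, $(a+b)^*=a^*+b^*$. $b$ is the Moore-Penrose inverse of $a$ if $aba=a$, $bab=b$, $(ab)^*=ab$, $(ba)^*=ba$; it is unique if it exists and is denoted $a^{\dagger}$; $R^{\dagger}$ is the set of Moore-Penrose invertible elements. A projection is an element $p$ with $p^2=p=p^*$; an idempotent is an element $e$ with $e^2=e$. An element $z$ is right invertible if $zx=1$ for some $x\in R$. *)

theory Defs
  imports Main
begin

text \<open>
  Unital rings with involution. The base is \<open>ring\<close> together with \<open>monoid_mult\<close> instead of
  \<open>ring_1\<close>, because \<open>ring_1\<close> postulates \<open>0 \<noteq> 1\<close> and would exclude the zero ring.
\<close>

class involution_ring = ring + monoid_mult +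
  fixes star :: "'a \<Rightarrow> 'a"  ("_\<^sup>\<star>" [1000] 1000)
  assumes star_star [simp]: "(a\<^sup>\<star>)\<^sup>\<star> = a"
    and star_mult: "(a * b)\<^sup>\<star> = b\<^sup>\<star> * a\<^sup>\<star>"
    and star_add: "(a + b)\<^sup>\<star> = a\<^sup>\<star> + b\<^sup>\<star>"

definition is_mp_inverse :: "'a::involution_ring \<Rightarrow> 'a \<Rightarrow> bool" where
  "is_mp_inverse a b \<longleftrightarrow>
     a * b * a = a \<and> b * a * b = b \<and> (a * b)\<^sup>\<star> = a * b \<and> (b * a)\<^sup>\<star> = b * a"

definition mp_invertibles :: "'a::involution_ring set"  ("R\<^sup>\<dagger>") where
  "R\<^sup>\<dagger> = {a. \<exists>b. is_mp_inverse a b}"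

lemma is_mp_inverse_unique:
  assumes "is_mp_inverse a b" and "is_mp_inverse a c"
  shows "b = c"
proof -
  have b: "a * b * a = a" "b * a * b = b" "(a * b)\<^sup>\<star> = a * b" "(b * a)\<^sup>\<star> = b * a"
    and c: "a * c * a = a" "c * a * c = c" "(a * c)\<^sup>\<star> = a * c" "(c * a)\<^sup>\<star> = c * a"
    using assms by (simp_all add: is_mp_inverse_def)
  have "a * b = (a * c) * (a * b)"
    using c(1) by (simp add: mult.assoc [symmetric])
  then have "(a * b)\<^sup>\<star> = ((a * c) * (a * b))\<^sup>\<star>"
    by simp
  also have "\<dots> = (a * b) * (a * c)"
    by (simp add: star_mult [of "a * c"] b c)
  also have "\<dots> = a * c"
    using b(1) by (simp add: mult.assoc [symmetric])
  finally have ab: "a * b = a * c"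
    using b(3) by simp
  have "b * a = (b * a) * (c * a)"
    using c(1) by (simp add: mult.assoc)
  then have "(b * a)\<^sup>\<star> = ((b * a) * (c * a))\<^sup>\<star>"
    by simp
  also have "\<dots> = (c * a) * (b * a)"
    by (simp add: star_mult [of "b * a"] b c)
  also have "\<dots> = c * a"
    using b(1) by (simp add: mult.assoc)
  finally have ba: "b * a = c * a"
    using b(4) by simp
  have "b = b * a * b" using b(2) by simp
  also have "\<dots> = c * (a * b)" by (simp add: ba mult.assoc)
  also have "\<dots> = c" using c(2) by (simp add: ab mult.assoc)
  finally show ?thesis .
qed

text \<open>Meaningful only for \<open>a \<in> R\<^sup>\<dagger>\<close>.\<close>

definition mp_inverse :: "'a::involution_ring \<Rightarrow> 'a"  ("_\<^sup>\<dagger>" [1000] 1000) where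
  "a\<^sup>\<dagger> = (THE b. is_mp_inverse a b)"

lemma mp_inverse_eqI: "is_mp_inverse a b \<Longrightarrow> a\<^sup>\<dagger> = b"
  unfolding mp_inverse_def by (blast intro: is_mp_inverse_unique)

lemma is_mp_inverse_mp_inverse: "a \<in> R\<^sup>\<dagger> \<Longrightarrow> is_mp_inverse a (a\<^sup>\<dagger>)"
  by (auto simp: mp_invertibles_def mp_inverse_eqI)

definition projection :: "'a::involution_ring \<Rightarrow> bool" where
  "projection p \<longleftrightarrow> p\<^sup>2 = p \<and> p = p\<^sup>\<star>"

definition idempotent :: "'a::monoid_mult \<Rightarrow> bool" where
  "idempotent e \<longleftrightarrow> e\<^sup>2 = e"

definition right_invertible :: "'a::monoid_mult \<Rightarrow> bool" where
  "right_invertible z \<longleftrightarrow> (\<exists>x. z * x = 1)"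

definition invertible :: "'a::monoid_mult \<Rightarrow> bool" where
  "invertible z \<longleftrightarrow> (\<exists>x. z * x = 1 \<and> x * z = 1)"

end

theory Submission
  imports Defs
begin

text \<open>
  Write \<open>h = a\<^sup>\<star> * a\<close>. All six conditions lie between the strongest one (a projection \<open>p\<close>, two-sided
  invertibility) and the weakest one (an arbitrary \<open>b\<close>, right invertibility), so it suffices to
  prove the strongest from Moore-Penrose invertibility, and Moore-Penrose invertibility together
  with the formula from the weakest.

  If \<open>a\<close> has Moore-Penrose inverse \<open>c\<close>, then \<open>q = c * a\<close> is a projection with \<open>a * q = a\<close>, and \<open>h\<close> has
  the inverse \<open>g = c * c\<^sup>\<star>\<close> inside the corner ring \<open>q R q\<close>. Adding the complementary projection
  \<open>p = 1 - q\<close> turns the inverse pair \<open>h ^ n\<close>, \<open>g ^ n\<close> of the corner into an inverse pair of \<open>R\<close>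
  (lemma \<open>corner_inverse_extends\<close>).

  Conversely, let \<open>a * b = 0\<close> and \<open>(h ^ n + b) * x = 1\<close>. Multiplying by \<open>a\<close> removes \<open>b\<close>, which leaves
  \<open>a = a * q\<close> with \<open>q = h ^ n * x\<close>. Applying the involution to \<open>h ^ n = h ^ n * q\<close> shows that
  \<open>q\<close> is self-adjoint, so \<open>q = x\<^sup>\<star> * h ^ n\<close> is a projection fixing \<open>a\<close> from the right.
  The candidate \<open>c = x\<^sup>\<star> * h ^ (2 * n - 1) * x * a\<^sup>\<star>\<close> makes \<open>a * c\<close> visibly
  self-adjoint; it also collapses to \<open>x\<^sup>\<star> * h ^ (n - 1) * a\<^sup>\<star>\<close>, so that \<open>c * a = q\<close>. These two
  shapes of \<open>c\<close> carry the proof (lemma \<open>is_mp_inverse_of_right_inverse\<close>).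
\<close>

lemma star_one [simp]: "(1::'a::involution_ring)\<^sup>\<star> = 1"
proof -
  have "(1::'a)\<^sup>\<star> = (1\<^sup>\<star>)\<^sup>\<star> * 1\<^sup>\<star>" by simp
  also have "\<dots> = (1 * 1\<^sup>\<star>)\<^sup>\<star>" by (simp only: star_mult)
  finally show ?thesis by simp
qed

lemma star_diff: "((u::'a::involution_ring) - v)\<^sup>\<star> = u\<^sup>\<star> - v\<^sup>\<star>"
  using star_add [of "u - v" v] by (simp add: algebra_simps)

lemma star_power: "((u::'a::involution_ring) ^ k)\<^sup>\<star> = (u\<^sup>\<star>) ^ k"
  by (induction k) (simp_all add: star_mult power_commutes)

lemma star_gram [simp]: "((a::'a::involution_ring)\<^sup>\<star> * a)\<^sup>\<star> = a\<^sup>\<star> * a"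
  by (simp add: star_mult)

lemma power_inverse_pair:
  fixes h g q :: "'a::monoid_mult"
  assumes "h * g = q" and "h * q = h"
  shows "h ^ Suc k * g ^ Suc k = q"
proof (induction k)
  case 0
  show ?case using assms by simp
next
  case (Suc k)
  \<comment> \<open>Cancel the innermost pair; the \<open>q\<close> it leaves is absorbed by the next \<open>h\<close>.\<close>
  have "h ^ Suc (Suc k) * g ^ Suc (Suc k) = h ^ Suc k * (h * g) * g ^ Suc k"
    by (simp only: power_Suc2 [of h "Suc k"] power_Suc [of g "Suc k"] mult.assoc)
  also have "\<dots> = h ^ Suc k * g ^ Suc k"
    by (simp only: assms(1) power_Suc2 [of h k] mult.assoc assms(2))
  finally show ?case using Suc.IH by simp
qed

text \<open>
  For \<open>h\<close> and \<open>g\<close> in the corner ring \<open>q R q\<close>, the two factors are block diagonal in the Peirce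
  decomposition with respect to \<open>q\<close>, with diagonals \<open>(h ^ n, 1)\<close> and \<open>(g ^ n, 1)\<close>. Only one product is treated, since exchanging \<open>h\<close> and \<open>g\<close>
  gives the other.
\<close>

lemma corner_inverse_extends:
  fixes h g q :: "'a::involution_ring"
  assumes "h * g = q" and hq: "h * q = h" and qg: "q * g = g" and qq: "q * q = q" and "n > 0"
  shows "(h ^ n + (1 - q)) * (g ^ n + (1 - q)) = 1"
proof -
  obtain k where n: "n = Suc k" using \<open>n > 0\<close> gr0_implies_Suc by blast
  have "h ^ n * g ^ n = q" unfolding n by (rule power_inverse_pair) fact+
  moreover have "h ^ n * q = h ^ n" by (simp only: n power_Suc2 mult.assoc hq)
  moreover have "q * g ^ n = g ^ n" by (simp only: n power_Suc mult.assoc [symmetric] qg)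
  ultimately show ?thesis using qq by (simp add: algebra_simps)
qed

lemma mp_invertible_imp_projection:
  fixes a :: "'a::involution_ring"
  assumes "a \<in> R\<^sup>\<dagger>" and "n > 0"
  shows "\<exists>p. projection p \<and> a * p = 0 \<and> invertible ((a\<^sup>\<star> * a) ^ n + p)"
proof -
  obtain c where aca: "a * c * a = a" and cac: "c * a * c = c"
    and ac: "(a * c)\<^sup>\<star> = a * c" and ca: "(c * a)\<^sup>\<star> = c * a"
    using assms(1) by (auto simp: mp_invertibles_def is_mp_inverse_def)
  define q h g where "q = c * a" and "h = a\<^sup>\<star> * a" and "g = c * c\<^sup>\<star>"
  have qstar: "q\<^sup>\<star> = q" by (simp add: q_def ca)
  have qq: "q * q = q" using cac by (simp add: q_def mult.assoc [symmetric])
  have aq: "a * q = a" using aca by (simp add: q_def mult.assoc)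
  have hq: "h * q = h" by (simp add: h_def mult.assoc aq)
  have qg: "q * g = g" using cac by (simp add: q_def g_def mult.assoc [symmetric])
  have hstar: "h\<^sup>\<star> = h" by (simp add: h_def)
  have gstar: "g\<^sup>\<star> = g" by (simp add: g_def star_mult)
  have gq: "g * q = g"
    using qg star_mult [of q g] by (simp add: qstar gstar)
  have hg: "h * g = q"
  proof -
    have "h * g = a\<^sup>\<star> * (a * c) * c\<^sup>\<star>" by (simp add: h_def g_def mult.assoc)
    also have "\<dots> = (c * (a * c * a))\<^sup>\<star>" using ac by (simp add: star_mult mult.assoc)
    also have "\<dots> = q" by (simp add: aca ca q_def)
    finally show ?thesis .
  qed
  have gh: "g * h = q"
    using star_mult [of h g] by (simp add: hg qstar gstar hstar)
  have qh: "q * h = h"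
    using star_mult [of h q] by (simp add: hq qstar hstar)
  have "projection (1 - q)"
    by (simp add: projection_def power2_eq_square algebra_simps qq star_diff qstar)
  moreover have "a * (1 - q) = 0" by (simp add: algebra_simps aq)
  moreover have "invertible (h ^ n + (1 - q))"
    unfolding invertible_def
    using corner_inverse_extends [OF hg hq qg qq \<open>n > 0\<close>]
      corner_inverse_extends [OF gh gq qh qq \<open>n > 0\<close>] by blast
  ultimately show ?thesis unfolding h_def by blast
qed

text \<open>
  Write \<open>c\<close> for the candidate and \<open>h = a\<^sup>\<star> * a\<close>, \<open>q = h ^ n * x\<close>. The least immediate identity is
  \<open>c * a * c = c\<close>. It uses the other ones: \<open>a * c * a = a\<close> and \<open>(a * c)\<^sup>\<star> = a * c\<close> give \<open>a\<^sup>\<star> = a\<^sup>\<star> * a * c\<close>, and this turns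
  \<open>c = x\<^sup>\<star> * h ^ (n - 1) * a\<^sup>\<star>\<close> into \<open>c = x\<^sup>\<star> * h ^ n * c = q * c\<close>.
\<close>

lemma is_mp_inverse_of_right_inverse:
  fixes a b x :: "'a::involution_ring"
  assumes "n > 0" and ab: "a * b = 0" and one: "((a\<^sup>\<star> * a) ^ n + b) * x = 1"
  shows "is_mp_inverse a (x\<^sup>\<star> * (a\<^sup>\<star> * a) ^ (2 * n - 1) * x * a\<^sup>\<star>)"
proof -
  obtain m where n: "n = Suc m" using \<open>n > 0\<close> gr0_implies_Suc by blast
  define h q c where "h = a\<^sup>\<star> * a" and "q = h ^ n * x"
    and "c = x\<^sup>\<star> * h ^ (2 * n - 1) * x * a\<^sup>\<star>"
  have hk: "(h ^ k)\<^sup>\<star> = h ^ k" for k by (simp add: star_power h_def)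
  have aq: "a * q = a"
  proof -
    have "a = a * ((h ^ n + b) * x)" using one by (simp add: h_def)
    also have "\<dots> = a * q + (a * b) * x" by (simp only: q_def distrib_left distrib_right mult.assoc)
    finally show ?thesis by (simp add: ab)
  qed
  have hq: "h ^ n * q = h ^ n"
    unfolding n power_Suc2 by (simp add: h_def mult.assoc aq)
  \<comment> \<open>\<open>q\<close> is self-adjoint because \<open>q\<^sup>\<star> * q\<close> reduces both to \<open>q\<close> and to \<open>q\<^sup>\<star>\<close>.\<close>
  have qstar_eq: "q\<^sup>\<star> = x\<^sup>\<star> * h ^ n" by (simp add: q_def star_mult hk)
  have "q\<^sup>\<star> * h ^ n = h ^ n" using arg_cong [OF hq, of star] by (simp add: star_mult hk)
  then have "q\<^sup>\<star> * q = q" by (simp add: q_def mult.assoc [symmetric])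
  moreover have "q\<^sup>\<star> * q = q\<^sup>\<star>" by (simp add: qstar_eq mult.assoc hq)
  ultimately have qstar: "q\<^sup>\<star> = q" by simp
  have xh: "x\<^sup>\<star> * h ^ n = q" using qstar_eq qstar by simp
  have qa: "q * a\<^sup>\<star> = a\<^sup>\<star>" using arg_cong [OF aq, of star] by (simp add: star_mult qstar)
  have c_short: "c = x\<^sup>\<star> * h ^ m * a\<^sup>\<star>"
  proof -
    have exponent: "2 * n - 1 = m + n" by (simp add: n)
    have "c = x\<^sup>\<star> * h ^ m * (q * a\<^sup>\<star>)"
      by (simp only: c_def exponent power_add q_def mult.assoc)
    then show ?thesis by (simp add: qa)
  qed
  have ca: "c * a = q"
  proof -
    have "c * a = x\<^sup>\<star> * h ^ n"
      unfolding c_short n power_Suc2 by (simp add: h_def mult.assoc)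
    then show ?thesis by (simp add: xh)
  qed
  have ac: "(a * c)\<^sup>\<star> = a * c" by (simp add: c_def star_mult hk mult.assoc)
  have aca: "a * c * a = a" by (simp add: mult.assoc ca aq)
  have "a\<^sup>\<star> = a\<^sup>\<star> * (a * c)"
    using arg_cong [OF aca, of star] star_mult [of "a * c" a] by (simp add: ac)
  then have "c = x\<^sup>\<star> * h ^ m * (a\<^sup>\<star> * (a * c))" using c_short by simp
  also have "\<dots> = x\<^sup>\<star> * h ^ n * c" unfolding n power_Suc2 by (simp add: h_def mult.assoc)
  finally have "c * a * c = c" by (simp add: xh ca)
  then show ?thesis
    using aca ac ca qstar by (simp add: is_mp_inverse_def c_def h_def)
qed

theorem theorem3p7:
  fixes a :: "'a::involution_ring" and n :: nat
  assumes "n > 0"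
  shows
    "((a \<in> R\<^sup>\<dagger>) \<longleftrightarrow> (\<exists>p. projection p \<and> a * p = 0 \<and> invertible ((a\<^sup>\<star> * a) ^ n + p)))
   \<and> ((a \<in> R\<^sup>\<dagger>) \<longleftrightarrow> (\<exists>p. projection p \<and> a * p = 0 \<and> right_invertible ((a\<^sup>\<star> * a) ^ n + p)))
   \<and> ((a \<in> R\<^sup>\<dagger>) \<longleftrightarrow> (\<exists>e. idempotent e \<and> a * e = 0 \<and> invertible ((a\<^sup>\<star> * a) ^ n + e)))
   \<and> ((a \<in> R\<^sup>\<dagger>) \<longleftrightarrow> (\<exists>e. idempotent e \<and> a * e = 0 \<and> right_invertible ((a\<^sup>\<star> * a) ^ n + e)))
   \<and> ((a \<in> R\<^sup>\<dagger>) \<longleftrightarrow> (\<exists>b. a * b = 0 \<and> invertible ((a\<^sup>\<star> * a) ^ n + b)))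
   \<and> ((a \<in> R\<^sup>\<dagger>) \<longleftrightarrow> (\<exists>b. a * b = 0 \<and> right_invertible ((a\<^sup>\<star> * a) ^ n + b)))
   \<and> (\<forall>p x\<^sub>1. projection p \<and> a * p = 0 \<and> 1 = ((a\<^sup>\<star> * a) ^ n + p) * x\<^sub>1
        \<longrightarrow> a\<^sup>\<dagger> = x\<^sub>1\<^sup>\<star> * (a\<^sup>\<star> * a) ^ (2 * n - 1) * x\<^sub>1 * a\<^sup>\<star>)
   \<and> (\<forall>e x\<^sub>2. idempotent e \<and> a * e = 0 \<and> 1 = ((a\<^sup>\<star> * a) ^ n + e) * x\<^sub>2
        \<longrightarrow> a\<^sup>\<dagger> = x\<^sub>2\<^sup>\<star> * (a\<^sup>\<star> * a) ^ (2 * n - 1) * x\<^sub>2 * a\<^sup>\<star>)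
   \<and> (\<forall>b x\<^sub>3. a * b = 0 \<and> 1 = ((a\<^sup>\<star> * a) ^ n + b) * x\<^sub>3
        \<longrightarrow> a\<^sup>\<dagger> = x\<^sub>3\<^sup>\<star> * (a\<^sup>\<star> * a) ^ (2 * n - 1) * x\<^sub>3 * a\<^sup>\<star>)"
proof -
  have formula: "a\<^sup>\<dagger> = x\<^sup>\<star> * (a\<^sup>\<star> * a) ^ (2 * n - 1) * x * a\<^sup>\<star>"
    if "a * b = 0" "1 = ((a\<^sup>\<star> * a) ^ n + b) * x" for b x
    using is_mp_inverse_of_right_inverse [OF assms that(1) that(2) [symmetric]]
    by (rule mp_inverse_eqI)
  have weakest: "a \<in> R\<^sup>\<dagger>" if "a * b = 0" "right_invertible ((a\<^sup>\<star> * a) ^ n + b)" for b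
    using that is_mp_inverse_of_right_inverse [OF assms]
    unfolding right_invertible_def mp_invertibles_def by blast
  have strongest: "\<exists>p. projection p \<and> a * p = 0 \<and> invertible ((a\<^sup>\<star> * a) ^ n + p)"
    if "a \<in> R\<^sup>\<dagger>"
    using that assms by (rule mp_invertible_imp_projection)
  have right: "right_invertible z" if "invertible z" for z :: 'a
    using that by (auto simp: invertible_def right_invertible_def)
  have idem: "idempotent p" if "projection p" for p :: 'a
    using that by (simp add: projection_def idempotent_def)
  show ?thesis
    by (intro conjI allI impI iffI) (use formula weakest strongest right idem in blast)+
qed

end
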